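(* Let $(\mathfrak{M},f)$ be an $\mathscr{L}_\varepsilon$-model, and let $T=\mathrm{Th}(\mathfrak{M},f)$. Then the function $$\Phi:\mathrm{Nr}_1\,\mathbf{LT}\,\mathfrak{M}f\to\mathrm{Can}\,\mathfrak{M}f,\qquad \Phi([\varphi])=[(\varepsilon v_0)\varphi]_{T}$$ is a surjection, and if $\mathbf{Can}\,\mathfrak{M}f$ denotes the cylindric algebra generated by $\Phi$ (the algebra induced on $\mathrm{Can}\,\mathfrak{M}f$ from $\mathbf{Nr}_1\,\mathbf{LT}\,\mathfrak{M}f$ via $\Phi$), then $$\frac{\mathbf{Nr}_1\,\mathbf{LT}\,\mathfrak{M}f}{\mathrm{Ker}\,\Phi}\cong\mathbf{Can}\,\mathfrak{M}f.$$
   Context: Epsilon language. $\mathsf{t}=(r_i,f_j,c_k)$ is a similarity type of relation, function and constant symbols. $\mathscr{L}_\varepsilon$ is the language with equality freely generated by $\neg,\vee,\varepsilon$ and $\mathsf{t}$: terms and formulae are defined simultaneously; variables, constants and $f_j(t_1,\dots,t_m)$ are terms, and for every formula $\varphi$ and variable $v_i$, $(\varepsilon v_i)\varphi$ is a term, in which $v_i$ is bound. $(\exists v_i)\varphi$ is $\varphi[(\varepsilon v_i)\varphi/v_i]$ and $(\forall v_i)\varphi$ is $\varphi[(\varepsilon v_i)\neg\varphi/v_i]$. $\mathrm{Fm}_{v_i}(\mathscr{L}_\varepsilon)$ is the set of formulae with no free variable other than $v_i$. Calculus. $\vdash$ is provability in the extensional epsilon calculus: classical propositional logic with equality together with the axiom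 of transfinity $\varphi[t/v_i]\rightarrow\varphi[(\varepsilon v_i)\varphi/v_i]$ and the axiom of extensionality $(\forall v_i)(\varphi\leftrightarrow\psi)\rightarrow(\varepsilon v_i)\varphi=(\varepsilon v_i)\psi$. It is known to be complete with respect to choice structures. Choice structures. A choice function on $M$ is a function $f:\mathrm{Sb}(M)\to M$ on the power set with $f(S)\in S$ for every nonempty $S\subseteq M$ ($f(\emptyset)\in M$ arbitrary). An $\mathscr{L}_\varepsilon$-model (choice structure) is a pair $(\mathfrak{M},f)$ with $\mathfrak{M}$ a first-order $\mathsf{t}$-structure on $M$ and $f$ a choice function on $M$; evaluation is as usual, with $((\varepsilon v_i)\varphi)^{\mathfrak{M}f}[a]=f(\{m\in M\mid(\mathfrak{M},f)\models\varphi[a(v_i\mapsto m)]\})$. $\mathrm{Th}(\mathfrak{M},f)$ is the set of $\mathscr{L}_\varepsilon$-sentences true in $(\mathfrak{M},f)$. Universe of the canonical model. Let $\mathrm{Eps}_1=\{(\varepsilon v_i)\varphi\mid v_i \text{ a variable},\ \varphi\in\mathrm{Fm}_{v_i}(\mathscr{L}_\varepsilon)\}$. For $T=\mathrm{Th}(\mathfrak{M},f)$ put $t_1=_Tt_2$ iff $T\vdash t_1=t_2$, write $[t]_T$ for the class of $t$, and $\mathrm{Can}\,\mathfrak{M}f=\mathrm{Eps}_1/\!=_T$. Algebras. $\mathbf{LT}\,\mathfrak{M}f$ is the Lindenbaum--Tarski algebra: the cylindric algebra of $\mathscr{L}_\varepsilon$-formulae modulo the relation $(\mathfrak{M},f)\models\varphi\leftrightarrow\psi$;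 $[\varphi]$ is the class of $\varphi$, the Boolean operations come from the connectives, the cylindrifications are $c_i[\varphi]=[(\exists v_i)\varphi]$, the diagonals are $d_{ij}=[v_i=v_j]$. For a cylindric algebra $\mathbf{A}$, the neat-1-reduct $\mathbf{Nr}_1\mathbf{A}$ is the one-dimensional cylindric (monadic) algebra of those elements $x$ with $c_ix=x$ for all $i\geq1$, with the Boolean operations, $c_0$ and $d_{00}$; its universe is $\mathrm{Nr}_1\mathbf{A}$. In the definition of $\Phi$ the class is represented by a formula $\varphi$ with at most $v_0$ free. The cylindric algebra generated by $\Phi$ is the algebra on $\mathrm{Can}\,\mathfrak{M}f$ whose operations are the images of those of $\mathbf{Nr}_1\,\mathbf{LT}\,\mathfrak{M}f$ under $\Phi$, i.e. for which $\Phi$ is a homomorphism: $-\Phi(x)=\Phi(-x)$, $\Phi(x)+\Phi(y)=\Phi(x+y)$, $c_0\Phi(x)=\Phi(c_0x)$, and so on. $\mathrm{Ker}\,\Phi=\{(x,y)\mid\Phi(x)=\Phi(y)\}$.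
   Formalization: For |M|≥2, Ker Φ is no congruence, so the induced algebra does not exist; its operations are taken as images of graphs (maybe multivalued), and the ordinary isomorphism is stated for any algebra on Can making Φ a homomorphism. Signatures have at least one symbol of each kind. *)

theory Defs
  imports Main
begin

section \<open>The epsilon language\<close>

record ('r, 'f) sim_type =
  rel_ar :: "'r \<Rightarrow> nat"
  fun_ar :: "'f \<Rightarrow> nat"

text \<open>
  \<open>Var i\<close> is the variable \<open>v\<^sub>i\<close> and \<open>EpsT i \<phi>\<close> is \<open>(\<epsilon> v\<^sub>i)\<phi>\<close>. Variables are named and terms are not
  identified up to renaming of bound variables. The arities are imposed by \<open>wft\<close> and \<open>wff\<close>.
\<close>

datatype ('r, 'f, 'c) trm =
    Var nat
  | Cst 'c
  | App 'f "('r, 'f, 'c) trm list"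
  | EpsT nat "('r, 'f, 'c) fm"
and ('r, 'f, 'c) fm =
    Rel 'r "('r, 'f, 'c) trm list"
  | Eq "('r, 'f, 'c) trm" "('r, 'f, 'c) trm"
  | Neg "('r, 'f, 'c) fm"
  | Or "('r, 'f, 'c) fm" "('r, 'f, 'c) fm"

fun wft :: "('r, 'f) sim_type \<Rightarrow> ('r, 'f, 'c) trm \<Rightarrow> bool"
  and wff :: "('r, 'f) sim_type \<Rightarrow> ('r, 'f, 'c) fm \<Rightarrow> bool" where
  "wft \<tau> (Var i) = True"
| "wft \<tau> (Cst c) = True"
| "wft \<tau> (App g ts) = (length ts = fun_ar \<tau> g \<and> (\<forall>t \<in> set ts. wft \<tau> t))"
| "wft \<tau> (EpsT i \<phi>) = wff \<tau> \<phi>"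
| "wff \<tau> (Rel r ts) = (length ts = rel_ar \<tau> r \<and> (\<forall>t \<in> set ts. wft \<tau> t))"
| "wff \<tau> (Eq s t) = (wft \<tau> s \<and> wft \<tau> t)"
| "wff \<tau> (Neg \<phi>) = wff \<tau> \<phi>"
| "wff \<tau> (Or \<phi> \<psi>) = (wff \<tau> \<phi> \<and> wff \<tau> \<psi>)"

fun fvt :: "('r, 'f, 'c) trm \<Rightarrow> nat set"
  and fvf :: "('r, 'f, 'c) fm \<Rightarrow> nat set" where
  "fvt (Var i) = {i}"
| "fvt (Cst c) = {}"
| "fvt (App g ts) = (\<Union>t \<in> set ts. fvt t)"
| "fvt (EpsT i \<phi>) = fvf \<phi> - {i}"
| "fvf (Rel r ts) = (\<Union>t \<in> set ts. fvt t)"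
| "fvf (Eq s t) = fvt s \<union> fvt t"
| "fvf (Neg \<phi>) = fvf \<phi>"
| "fvf (Or \<phi> \<psi>) = fvf \<phi> \<union> fvf \<psi>"

text \<open>
  Simultaneous capture-avoiding substitution. A bound variable is renamed only if it would capture
  a variable of a term that is substituted for a free variable in its scope; the new name is the
  least variable that causes no capture.
\<close>

definition bound_name :: "nat \<Rightarrow> nat set \<Rightarrow> nat" where
  "bound_name i B = (if i \<notin> B then i else (LEAST k. k \<notin> B))"

fun subt :: "(nat \<Rightarrow> ('r, 'f, 'c) trm) \<Rightarrow> ('r, 'f, 'c) trm \<Rightarrow> ('r, 'f, 'c) trm"
  and subf :: "(nat \<Rightarrow> ('r, 'f, 'c) trm) \<Rightarrow> ('r, 'f, 'c) fm \<Rightarrow> ('r, 'f, 'c) fm" where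
  "subt \<sigma> (Var i) = \<sigma> i"
| "subt \<sigma> (Cst c) = Cst c"
| "subt \<sigma> (App g ts) = App g (map (subt \<sigma>) ts)"
| "subt \<sigma> (EpsT i \<phi>) =
     (let j = bound_name i (\<Union>x \<in> fvf \<phi> - {i}. fvt (\<sigma> x)) in EpsT j (subf (\<sigma>(i := Var j)) \<phi>))"
| "subf \<sigma> (Rel r ts) = Rel r (map (subt \<sigma>) ts)"
| "subf \<sigma> (Eq s t) = Eq (subt \<sigma> s) (subt \<sigma> t)"
| "subf \<sigma> (Neg \<phi>) = Neg (subf \<sigma> \<phi>)"
| "subf \<sigma> (Or \<phi> \<psi>) = Or (subf \<sigma> \<phi>) (subf \<sigma> \<psi>)"

definition inst :: "('r, 'f, 'c) fm \<Rightarrow> ('r, 'f, 'c) trm \<Rightarrow> nat \<Rightarrow> ('r, 'f, 'c) fm"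
    (\<open>_[_'/'/_]\<close> [1000, 0, 0] 1000) where
  "\<phi>[t//i] = subf (Var(i := t)) \<phi>"

definition Imp :: "('r, 'f, 'c) fm \<Rightarrow> ('r, 'f, 'c) fm \<Rightarrow> ('r, 'f, 'c) fm" where
  "Imp \<phi> \<psi> = Or (Neg \<phi>) \<psi>"

definition And :: "('r, 'f, 'c) fm \<Rightarrow> ('r, 'f, 'c) fm \<Rightarrow> ('r, 'f, 'c) fm" where
  "And \<phi> \<psi> = Neg (Or (Neg \<phi>) (Neg \<psi>))"

definition Iff :: "('r, 'f, 'c) fm \<Rightarrow> ('r, 'f, 'c) fm \<Rightarrow> ('r, 'f, 'c) fm" where
  "Iff \<phi> \<psi> = And (Imp \<phi> \<psi>) (Imp \<psi> \<phi>)"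

definition ExF :: "nat \<Rightarrow> ('r, 'f, 'c) fm \<Rightarrow> ('r, 'f, 'c) fm" where
  "ExF i \<phi> = \<phi>[EpsT i \<phi>//i]"

definition AllF :: "nat \<Rightarrow> ('r, 'f, 'c) fm \<Rightarrow> ('r, 'f, 'c) fm" where
  "AllF i \<phi> = \<phi>[EpsT i (Neg \<phi>)//i]"

section \<open>The extensional epsilon calculus\<close>

fun bool_val :: "(('r, 'f, 'c) fm \<Rightarrow> bool) \<Rightarrow> ('r, 'f, 'c) fm \<Rightarrow> bool" where
  "bool_val h (Neg \<phi>) = (\<not> bool_val h \<phi>)"
| "bool_val h (Or \<phi> \<psi>) = (bool_val h \<phi> \<or> bool_val h \<psi>)"
| "bool_val h \<phi> = h \<phi>"

inductive proves :: "('r, 'f) sim_type \<Rightarrow> ('r, 'f, 'c) fm set \<Rightarrow> ('r, 'f, 'c) fm \<Rightarrow> bool"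
  for \<tau> T where
  hypothesis: "\<phi> \<in> T \<Longrightarrow> wff \<tau> \<phi> \<Longrightarrow> proves \<tau> T \<phi>"
| tautology: "wff \<tau> \<phi> \<Longrightarrow> (\<And>h. bool_val h \<phi>) \<Longrightarrow> proves \<tau> T \<phi>"
| identity: "wft \<tau> t \<Longrightarrow> proves \<tau> T (Eq t t)"
| leibniz: "wff \<tau> \<phi> \<Longrightarrow> wft \<tau> s \<Longrightarrow> wft \<tau> t \<Longrightarrow>
    proves \<tau> T (Imp (Eq s t) (Imp (\<phi>[s//i]) (\<phi>[t//i])))"
| transfinity: "wff \<tau> \<phi> \<Longrightarrow> wft \<tau> t \<Longrightarrow> proves \<tau> T (Imp (\<phi>[t//i]) (\<phi>[EpsT i \<phi>//i]))"
| extensionality: "wff \<tau> \<phi> \<Longrightarrow> wff \<tau> \<psi> \<Longrightarrow>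
    proves \<tau> T (Imp (AllF i (Iff \<phi> \<psi>)) (Eq (EpsT i \<phi>) (EpsT i \<psi>)))"
| detachment: "proves \<tau> T (Imp \<phi> \<psi>) \<Longrightarrow> proves \<tau> T \<phi> \<Longrightarrow> proves \<tau> T \<psi>"

section \<open>Choice structures\<close>

record ('r, 'f, 'c, 'm) fo_struct =
  univ :: "'m set"
  rel_of :: "'r \<Rightarrow> 'm list set"
  fun_of :: "'f \<Rightarrow> 'm list \<Rightarrow> 'm"
  cst_of :: "'c \<Rightarrow> 'm"

definition is_fo_struct :: "('r, 'f) sim_type \<Rightarrow> ('r, 'f, 'c, 'm) fo_struct \<Rightarrow> bool" where
  "is_fo_struct \<tau> M \<longleftrightarrow>
     univ M \<noteq> {} \<and>
     (\<forall>r. rel_of M r \<subseteq> {xs. length xs = rel_ar \<tau> r \<and> set xs \<subseteq> univ M}) \<and>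
     (\<forall>g xs. length xs = fun_ar \<tau> g \<and> set xs \<subseteq> univ M \<longrightarrow> fun_of M g xs \<in> univ M) \<and>
     (\<forall>c. cst_of M c \<in> univ M)"

definition choice_function :: "'m set \<Rightarrow> ('m set \<Rightarrow> 'm) \<Rightarrow> bool" where
  "choice_function U f \<longleftrightarrow> (\<forall>S \<subseteq> U. f S \<in> U \<and> (S \<noteq> {} \<longrightarrow> f S \<in> S))"

definition choice_structure ::
    "('r, 'f) sim_type \<Rightarrow> ('r, 'f, 'c, 'm) fo_struct \<Rightarrow> ('m set \<Rightarrow> 'm) \<Rightarrow> bool" where
  "choice_structure \<tau> M f \<longleftrightarrow> is_fo_struct \<tau> M \<and> choice_function (univ M) f"

fun evt :: "('r, 'f, 'c, 'm) fo_struct \<Rightarrow> ('m set \<Rightarrow> 'm) \<Rightarrow> (nat \<Rightarrow> 'm) \<Rightarrow> ('r, 'f, 'c) trm \<Rightarrow> 'm"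
  and sat :: "('r, 'f, 'c, 'm) fo_struct \<Rightarrow> ('m set \<Rightarrow> 'm) \<Rightarrow> (nat \<Rightarrow> 'm) \<Rightarrow> ('r, 'f, 'c) fm \<Rightarrow> bool"
  where
  "evt M f a (Var i) = a i"
| "evt M f a (Cst c) = cst_of M c"
| "evt M f a (App g ts) = fun_of M g (map (evt M f a) ts)"
| "evt M f a (EpsT i \<phi>) = f {m \<in> univ M. sat M f (a(i := m)) \<phi>}"
| "sat M f a (Rel r ts) = (map (evt M f a) ts \<in> rel_of M r)"
| "sat M f a (Eq s t) = (evt M f a s = evt M f a t)"
| "sat M f a (Neg \<phi>) = (\<not> sat M f a \<phi>)"
| "sat M f a (Or \<phi> \<psi>) = (sat M f a \<phi> \<or> sat M f a \<psi>)"

definition models :: "('r, 'f, 'c, 'm) fo_struct \<Rightarrow> ('m set \<Rightarrow> 'm) \<Rightarrow> ('r, 'f, 'c) fm \<Rightarrow> bool" where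
  "models M f \<phi> \<longleftrightarrow> (\<forall>a. range a \<subseteq> univ M \<longrightarrow> sat M f a \<phi>)"

definition Th ::
    "('r, 'f) sim_type \<Rightarrow> ('r, 'f, 'c, 'm) fo_struct \<Rightarrow> ('m set \<Rightarrow> 'm) \<Rightarrow> ('r, 'f, 'c) fm set" where
  "Th \<tau> M f = {\<phi>. wff \<tau> \<phi> \<and> fvf \<phi> = {} \<and> models M f \<phi>}"

section \<open>The universe of the canonical model\<close>

definition Eps1 :: "('r, 'f) sim_type \<Rightarrow> ('r, 'f, 'c) trm set" where
  "Eps1 \<tau> = {EpsT i \<phi> | i \<phi>. wff \<tau> \<phi> \<and> fvf \<phi> \<subseteq> {i}}"

definition eq_rel ::
    "('r, 'f) sim_type \<Rightarrow> ('r, 'f, 'c) fm set \<Rightarrow> (('r, 'f, 'c) trm \<times> ('r, 'f, 'c) trm) set" where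
  "eq_rel \<tau> T = {(s, t). s \<in> Eps1 \<tau> \<and> t \<in> Eps1 \<tau> \<and> proves \<tau> T (Eq s t)}"

definition trm_class ::
    "('r, 'f) sim_type \<Rightarrow> ('r, 'f, 'c) fm set \<Rightarrow> ('r, 'f, 'c) trm \<Rightarrow> ('r, 'f, 'c) trm set" where
  "trm_class \<tau> T t = eq_rel \<tau> T `` {t}"

definition Can ::
    "('r, 'f) sim_type \<Rightarrow> ('r, 'f, 'c, 'm) fo_struct \<Rightarrow> ('m set \<Rightarrow> 'm) \<Rightarrow> ('r, 'f, 'c) trm set set" where
  "Can \<tau> M f = Eps1 \<tau> // eq_rel \<tau> (Th \<tau> M f)"

section \<open>Algebras of cylindric type\<close>

datatype cyl_op = Join | Meet | Compl | Zero | One | Cyl nat | Diag nat nat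

fun op_ar :: "cyl_op \<Rightarrow> nat" where
  "op_ar Join = 2"
| "op_ar Meet = 2"
| "op_ar Compl = 1"
| "op_ar Zero = 0"
| "op_ar One = 0"
| "op_ar (Cyl i) = 1"
| "op_ar (Diag i j) = 0"

definition cyl_ops :: "nat set \<Rightarrow> cyl_op set" where
  "cyl_ops I = {Join, Meet, Compl, Zero, One} \<union> Cyl ` I \<union> {Diag i j | i j. i \<in> I \<and> j \<in> I}"

text \<open>
  Each operation is given by its graph, a set of pairs of an argument list and a value, so that the
  image of an operation under any map is defined outright. The image of a total single-valued
  operation under a map whose kernel is not a congruence need not be single-valued; \<open>is_algebra\<close>
  says that every operation is total and single-valued, i.e. that one has an algebra in the
  ordinary sense.
\<close>

record 'a calg =
  carrier :: "'a set"
  graph :: "cyl_op \<Rightarrow> ('a list \<times> 'a) set"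

definition op_args :: "'a set \<Rightarrow> cyl_op \<Rightarrow> 'a list set" where
  "op_args U s = {xs. length xs = op_ar s \<and> set xs \<subseteq> U}"

definition is_algebra :: "nat set \<Rightarrow> 'a calg \<Rightarrow> bool" where
  "is_algebra I A \<longleftrightarrow>
     (\<forall>s \<in> cyl_ops I.
        graph A s \<subseteq> op_args (carrier A) s \<times> carrier A \<and>
        (\<forall>xs \<in> op_args (carrier A) s. \<exists>!y. (xs, y) \<in> graph A s))"

definition image_alg :: "('a \<Rightarrow> 'b) \<Rightarrow> 'a calg \<Rightarrow> 'b calg" where
  "image_alg h A = \<lparr>carrier = h ` carrier A, graph = (\<lambda>s. map_prod (map h) h ` graph A s)\<rparr>"

definition is_hom :: "nat set \<Rightarrow> 'a calg \<Rightarrow> 'b calg \<Rightarrow> ('a \<Rightarrow> 'b) \<Rightarrow> bool" where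
  "is_hom I A B h \<longleftrightarrow>
     h ` carrier A \<subseteq> carrier B \<and>
     (\<forall>s \<in> cyl_ops I. \<forall>xs y. (xs, y) \<in> graph A s \<longrightarrow> (map h xs, h y) \<in> graph B s)"

definition isomorphic :: "nat set \<Rightarrow> 'a calg \<Rightarrow> 'b calg \<Rightarrow> bool" where
  "isomorphic I A B \<longleftrightarrow>
     (\<exists>h. bij_betw h (carrier A) (carrier B) \<and>
          (\<forall>s \<in> cyl_ops I. map_prod (map h) h ` graph A s = graph B s))"

definition Ker :: "'a calg \<Rightarrow> ('a \<Rightarrow> 'b) \<Rightarrow> ('a \<times> 'a) set" where
  "Ker A h = {(x, y). x \<in> carrier A \<and> y \<in> carrier A \<and> h x = h y}"

definition quot_alg :: "'a calg \<Rightarrow> ('a \<times> 'a) set \<Rightarrow> 'a set calg" where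
  "quot_alg A \<theta> = image_alg (\<lambda>x. \<theta> `` {x}) A"

definition Nr1 :: "'a calg \<Rightarrow> 'a calg" where
  "Nr1 A =
     (let U = {x \<in> carrier A. \<forall>i \<ge> 1. ([x], x) \<in> graph A (Cyl i)} in
      \<lparr>carrier = U,
       graph = (\<lambda>s. if s \<in> cyl_ops {0} then graph A s \<inter> (op_args U s \<times> U) else {})\<rparr>)"

section \<open>The Lindenbaum-Tarski algebra\<close>

fun fm_op :: "cyl_op \<Rightarrow> ('r, 'f, 'c) fm list \<Rightarrow> ('r, 'f, 'c) fm" where
  "fm_op Join [\<phi>, \<psi>] = Or \<phi> \<psi>"
| "fm_op Meet [\<phi>, \<psi>] = And \<phi> \<psi>"
| "fm_op Compl [\<phi>] = Neg \<phi>"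
| "fm_op Zero [] = Neg (Eq (Var 0) (Var 0))"
| "fm_op One [] = Eq (Var 0) (Var 0)"
| "fm_op (Cyl i) [\<phi>] = ExF i \<phi>"
| "fm_op (Diag i j) [] = Eq (Var i) (Var j)"

definition fm_alg :: "('r, 'f) sim_type \<Rightarrow> ('r, 'f, 'c) fm calg" where
  "fm_alg \<tau> =
     \<lparr>carrier = {\<phi>. wff \<tau> \<phi>},
      graph = (\<lambda>s. {(\<phi>s, fm_op s \<phi>s) | \<phi>s. \<phi>s \<in> op_args {\<phi>. wff \<tau> \<phi>} s})\<rparr>"

definition iff_rel ::
    "('r, 'f) sim_type \<Rightarrow> ('r, 'f, 'c, 'm) fo_struct \<Rightarrow> ('m set \<Rightarrow> 'm) \<Rightarrow>
     (('r, 'f, 'c) fm \<times> ('r, 'f, 'c) fm) set" where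
  "iff_rel \<tau> M f = {(\<phi>, \<psi>). wff \<tau> \<phi> \<and> wff \<tau> \<psi> \<and> models M f (Iff \<phi> \<psi>)}"

definition fm_class ::
    "('r, 'f) sim_type \<Rightarrow> ('r, 'f, 'c, 'm) fo_struct \<Rightarrow> ('m set \<Rightarrow> 'm) \<Rightarrow>
     ('r, 'f, 'c) fm \<Rightarrow> ('r, 'f, 'c) fm set" where
  "fm_class \<tau> M f \<phi> = iff_rel \<tau> M f `` {\<phi>}"

definition LT ::
    "('r, 'f) sim_type \<Rightarrow> ('r, 'f, 'c, 'm) fo_struct \<Rightarrow> ('m set \<Rightarrow> 'm) \<Rightarrow> ('r, 'f, 'c) fm set calg" where
  "LT \<tau> M f = quot_alg (fm_alg \<tau>) (iff_rel \<tau> M f)"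

section \<open>The map onto the canonical model and the algebra it generates\<close>

text \<open>
  The union below is over representatives with at most \<open>v\<^sub>0\<close> free; when they all give the same class
  of terms, it is that class.
\<close>

definition Phi ::
    "('r, 'f) sim_type \<Rightarrow> ('r, 'f, 'c, 'm) fo_struct \<Rightarrow> ('m set \<Rightarrow> 'm) \<Rightarrow>
     ('r, 'f, 'c) fm set \<Rightarrow> ('r, 'f, 'c) trm set" where
  "Phi \<tau> M f x = (\<Union>\<phi> \<in> {\<phi> \<in> x. fvf \<phi> \<subseteq> {0}}. trm_class \<tau> (Th \<tau> M f) (EpsT 0 \<phi>))"

definition Can_alg ::
    "('r, 'f) sim_type \<Rightarrow> ('r, 'f, 'c, 'm) fo_struct \<Rightarrow> ('m set \<Rightarrow> 'm) \<Rightarrow> ('r, 'f, 'c) trm set calg" where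
  "Can_alg \<tau> M f = image_alg (Phi \<tau> M f) (Nr1 (LT \<tau> M f))"

end

theory Submission
  imports Defs
begin

text \<open>
  Everything is reduced to the semantics of the given choice structure. The calculus is sound
  (\<open>soundness\<close>), and an equation between closed terms that is true in the structure belongs to its
  theory \<open>T\<close>; hence two closed terms are provably equal from \<open>T\<close> iff they have the same value
  (\<open>proves_Eq_iff\<close>). Equivalent formulae \<open>\<phi>\<close> and \<open>\<psi>\<close> with at most \<open>v\<^sub>0\<close> free define the same subset of
  the universe, so the choice function gives \<open>(\<epsilon> v\<^sub>0)\<phi>\<close> and \<open>(\<epsilon> v\<^sub>0)\<psi>\<close> the same value, and \<open>\<Phi>\<close> is
  well defined (\<open>Phi_fm_class\<close>). It is onto because the bound variable \<open>v\<^sub>i\<close> of a closed epsilon term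
  can be replaced by \<open>v\<^sub>0\<close> without changing the value (\<open>Phi_surj\<close>).

  The neat reduct consists exactly of the classes of formulae with at most \<open>v\<^sub>0\<close> free
  (\<open>carrier_Nr1_LT\<close>): a class fixed by every \<open>c\<^sub>i\<close> with \<open>i \<ge> 1\<close> keeps its value when the other free
  variables of a representative are quantified away. As such formulae are closed under the
  operations, and the operations respect equivalence, the neat reduct is an algebra.

  The isomorphism claims do not involve formulae. The quotient of \<open>A\<close> by the kernel of a map \<open>h\<close> is
  isomorphic to the image of \<open>A\<close> under \<open>h\<close>, operation graphs included
  (\<open>quot_Ker_isomorphic_image\<close>), even if the operations of the image are not
  single-valued. If \<open>h\<close> is a homomorphism
  onto an algebra \<open>B\<close>, then the image of \<open>A\<close> is \<open>B\<close>, and the quotient is an algebra because \<open>B\<close> is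
  (\<open>quot_Ker_isomorphic\<close>).
\<close>

section \<open>Semantics of the epsilon language\<close>

lemma finite_fv:
  fixes t :: "('r, 'f, 'c) trm" and \<phi> :: "('r, 'f, 'c) fm"
  shows "finite (fvt t)" "finite (fvf \<phi>)"
  by (induction t and \<phi> rule: trm.induct fm.induct) auto

lemma bound_name_notin: "finite B \<Longrightarrow> bound_name i B \<notin> B"
  unfolding bound_name_def using LeastI_ex[OF ex_new_if_finite[OF infinite_UNIV_nat]] by auto

text \<open>The value of an expression depends only on the assignment to its free variables.\<close>

lemma coincidence:
  "(\<And>x. x \<in> fvt t \<Longrightarrow> a x = b x) \<Longrightarrow> evt M f a t = evt M f b t"
  "(\<And>x. x \<in> fvf \<phi> \<Longrightarrow> a x = b x) \<Longrightarrow> sat M f a \<phi> = sat M f b \<phi>"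
proof (induction M f a t and M f a \<phi> arbitrary: b and b rule: evt_sat.induct)
  case (3 M f a g ts)
  have "map (evt M f a) ts = map (evt M f b) ts"
    by (rule map_cong[OF refl], rule "3.IH") (use "3.prems" in auto)
  then show ?case by (simp only: evt.simps)
next
  case (4 M f a i \<phi>)
  have "sat M f (a(i := m)) \<phi> = sat M f (b(i := m)) \<phi>" for m
    by (intro "4.IH") (use "4.prems" in auto)
  then show ?case by simp
next
  case (5 M f a r ts)
  have "map (evt M f a) ts = map (evt M f b) ts"
    by (rule map_cong[OF refl], rule "5.IH") (use "5.prems" in auto)
  then show ?case by (simp only: sat.simps)
next
  case (6 M f a s t)
  have "evt M f a s = evt M f b s" "evt M f a t = evt M f b t"
    using "6.prems" by (auto intro!: "6.IH")
  then show ?case by simp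
next
  case (8 M f a \<phi> \<psi>)
  have "sat M f a \<phi> = sat M f b \<phi>" "sat M f a \<psi> = sat M f b \<psi>"
    using "8.prems" by (auto intro!: "8.IH")
  then show ?case by simp
qed auto

text \<open>
  The substitution lemma: substituting \<open>\<sigma>\<close> amounts to evaluating under the assignment
  \<open>x \<mapsto> evt M f a (\<sigma> x)\<close>.
\<close>

lemma evt_sat_subst:
  "evt M f a (subt \<sigma> t) = evt M f (\<lambda>x. evt M f a (\<sigma> x)) t"
  "sat M f a (subf \<sigma> \<phi>) = sat M f (\<lambda>x. evt M f a (\<sigma> x)) \<phi>"
proof (induction \<sigma> t and \<sigma> \<phi> arbitrary: a and a rule: subt_subf.induct)
  case (3 \<sigma> g ts)
  then have "map (evt M f a) (map (subt \<sigma>) ts) = map (evt M f (\<lambda>x. evt M f a (\<sigma> x))) ts"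
    by simp
  then show ?case by (simp only: subt.simps evt.simps)
next
  case (4 \<sigma> i \<phi>)
  define j where "j = bound_name i (\<Union>x \<in> fvf \<phi> - {i}. fvt (\<sigma> x))"
  \<comment> \<open>As \<open>j\<close> is free in no \<open>\<sigma> x\<close> that matters, changing the assignment at \<open>j\<close> affects only the
    bound variable.\<close>
  have "j \<notin> (\<Union>x \<in> fvf \<phi> - {i}. fvt (\<sigma> x))"
    unfolding j_def by (intro bound_name_notin) (simp add: finite_fv)
  then have "sat M f (\<lambda>x. evt M f (a(j := m)) ((\<sigma>(i := Var j)) x)) \<phi>
      = sat M f ((\<lambda>x. evt M f a (\<sigma> x))(i := m)) \<phi>" for m
    by (intro coincidence(2)) (auto intro!: coincidence(1))
  then show ?case
    using "4.IH"[OF j_def] by (simp add: j_def[symmetric] del: fun_upd_apply)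
next
  case (5 \<sigma> r ts)
  then have "map (evt M f a) (map (subt \<sigma>) ts) = map (evt M f (\<lambda>x. evt M f a (\<sigma> x))) ts"
    by simp
  then show ?case by (simp only: subf.simps sat.simps)
qed auto

lemma sat_inst: "sat M f a (\<phi>[t//i]) = sat M f (a(i := evt M f a t)) \<phi>"
  unfolding inst_def evt_sat_subst(2) by (rule coincidence) auto

lemma fv_subst:
  "fvt (subt \<sigma> t) \<subseteq> (\<Union>x \<in> fvt t. fvt (\<sigma> x))"
  "fvf (subf \<sigma> \<phi>) \<subseteq> (\<Union>x \<in> fvf \<phi>. fvt (\<sigma> x))"
proof (induction \<sigma> t and \<sigma> \<phi> rule: subt_subf.induct)
  case (4 \<sigma> i \<phi>)
  then show ?case
    by (fastforce simp: Let_def split: if_splits)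
qed auto

lemma wf_subst:
  "wft \<tau> t \<Longrightarrow> (\<And>x. wft \<tau> (\<sigma> x)) \<Longrightarrow> wft \<tau> (subt \<sigma> t)"
  "wff \<tau> \<phi> \<Longrightarrow> (\<And>x. wft \<tau> (\<sigma> x)) \<Longrightarrow> wff \<tau> (subf \<sigma> \<phi>)"
  by (induction \<sigma> t and \<sigma> \<phi> rule: subt_subf.induct) (auto simp: Let_def)

lemma fvf_inst: "fvf (\<phi>[t//i]) \<subseteq> (fvf \<phi> - {i}) \<union> fvt t"
  using fv_subst(2)[of "Var(i := t)" \<phi>] unfolding inst_def by (auto split: if_splits)

lemma wff_inst: "wff \<tau> \<phi> \<Longrightarrow> wft \<tau> t \<Longrightarrow> wff \<tau> (\<phi>[t//i])"
  unfolding inst_def by (rule wf_subst) auto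

lemma fvf_ExF: "fvf (ExF i \<phi>) \<subseteq> fvf \<phi> - {i}"
  using fvf_inst[of \<phi> "EpsT i \<phi>" i] by (auto simp: ExF_def)

lemma wff_ExF: "wff \<tau> \<phi> \<Longrightarrow> wff \<tau> (ExF i \<phi>)"
  by (simp add: ExF_def wff_inst)

lemma sat_connectives [simp]:
  "sat M f a (Imp \<phi> \<psi>) = (sat M f a \<phi> \<longrightarrow> sat M f a \<psi>)"
  "sat M f a (And \<phi> \<psi>) = (sat M f a \<phi> \<and> sat M f a \<psi>)"
  "sat M f a (Iff \<phi> \<psi>) = (sat M f a \<phi> \<longleftrightarrow> sat M f a \<psi>)"
  by (auto simp: Imp_def And_def Iff_def)

lemma wff_And [simp]: "wff \<tau> (And \<phi> \<psi>) = (wff \<tau> \<phi> \<and> wff \<tau> \<psi>)"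
  by (simp add: And_def)

lemma fvf_And [simp]: "fvf (And \<phi> \<psi>) = fvf \<phi> \<union> fvf \<psi>"
  by (simp add: And_def)

lemma choice_in_univ: "choice_structure \<tau> M f \<Longrightarrow> S \<subseteq> univ M \<Longrightarrow> f S \<in> univ M"
  by (auto simp: choice_structure_def choice_function_def)

lemma choice_in_set: "choice_structure \<tau> M f \<Longrightarrow> S \<subseteq> univ M \<Longrightarrow> m \<in> S \<Longrightarrow> f S \<in> S"
  by (auto simp: choice_structure_def choice_function_def)

lemma evt_in_univ:
  assumes "choice_structure \<tau> M f" "range a \<subseteq> univ M"
  shows "wft \<tau> t \<Longrightarrow> evt M f a t \<in> univ M"
proof (induction t rule: trm.induct[of _ "\<lambda>_. True"])
  case (App g ts)
  then have "length (map (evt M f a) ts) = fun_ar \<tau> g" "set (map (evt M f a) ts) \<subseteq> univ M"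
    by auto
  then show ?case
    using assms(1) unfolding choice_structure_def is_fo_struct_def evt.simps by blast
next
  case (EpsT i \<phi>)
  then show ?case by (auto intro: choice_in_univ[OF assms(1)])
qed (use assms in \<open>auto simp: choice_structure_def is_fo_struct_def\<close>)

text \<open>
  The epsilon quantifiers have their usual meaning: the value of \<open>EpsT i \<phi>\<close> is a witness
  whenever there is one.
\<close>

lemma sat_ExF:
  assumes "choice_structure \<tau> M f"
  shows "sat M f a (ExF i \<phi>) \<longleftrightarrow> (\<exists>m \<in> univ M. sat M f (a(i := m)) \<phi>)"
proof -
  let ?S = "{m \<in> univ M. sat M f (a(i := m)) \<phi>}"
  have "f ?S \<in> univ M" by (rule choice_in_univ[OF assms]) auto
  moreover have "f ?S \<in> ?S" if "m \<in> ?S" for m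
    by (rule choice_in_set[OF assms _ that]) auto
  ultimately show ?thesis by (auto simp: ExF_def sat_inst)
qed

lemma sat_AllF:
  assumes "choice_structure \<tau> M f"
  shows "sat M f a (AllF i \<phi>) \<longleftrightarrow> (\<forall>m \<in> univ M. sat M f (a(i := m)) \<phi>)"
  using sat_ExF[OF assms, of a i "Neg \<phi>"] by (auto simp: ExF_def AllF_def sat_inst)

text \<open>
  Satisfaction under a fixed assignment is a propositional valuation, which makes tautologies
  true.
\<close>

lemma bool_val_sat: "bool_val (sat M f a) \<phi> = sat M f a \<phi>"
  by (induction "sat M f a" \<phi> rule: bool_val.induct) auto

lemma soundness:
  assumes cs: "choice_structure \<tau> M f" and T: "\<And>\<phi>. \<phi> \<in> T \<Longrightarrow> models M f \<phi>"
  shows "proves \<tau> T \<phi> \<Longrightarrow> models M f \<phi>"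
proof (induction rule: proves.induct)
  case (hypothesis \<phi>)
  then show ?case using T by simp
next
  case (tautology \<phi>)
  then show ?case using bool_val_sat by (fastforce simp: models_def)
next
  case (transfinity \<phi> t i)
  have "sat M f a (\<phi>[EpsT i \<phi>//i])" if "range a \<subseteq> univ M" "sat M f a (\<phi>[t//i])" for a
    using sat_ExF[OF cs, of a i \<phi>] evt_in_univ[OF cs that(1) transfinity(2)] that(2)
    by (auto simp: ExF_def sat_inst)
  then show ?case by (simp add: models_def)
next
  case (extensionality \<phi> \<psi> i)
  have "evt M f a (EpsT i \<phi>) = evt M f a (EpsT i \<psi>)" if "sat M f a (AllF i (Iff \<phi> \<psi>))" for a
  proof -
    have "{m \<in> univ M. sat M f (a(i := m)) \<phi>} = {m \<in> univ M. sat M f (a(i := m)) \<psi>}"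
      using that by (auto simp: sat_AllF[OF cs])
    then show ?thesis by simp
  qed
  then show ?case by (simp add: models_def)
qed (auto simp: models_def sat_inst)

section \<open>The canonical universe and the Lindenbaum-Tarski algebra, semantically\<close>

lemma Eps1_closed: "t \<in> Eps1 \<tau> \<Longrightarrow> fvt t = {} \<and> wft \<tau> t"
  by (auto simp: Eps1_def)

text \<open>
  A closed term has the same value under all assignments, so an equation that holds under one
  assignment is a member of the theory; the converse is soundness.
\<close>

lemma proves_Eq_iff:
  assumes cs: "choice_structure \<tau> M f" and "s \<in> Eps1 \<tau>" "t \<in> Eps1 \<tau>"
    and a: "range a \<subseteq> univ M"
  shows "proves \<tau> (Th \<tau> M f) (Eq s t) \<longleftrightarrow> evt M f a s = evt M f a t"
proof
  assume "proves \<tau> (Th \<tau> M f) (Eq s t)"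
  then have "models M f (Eq s t)"
    by (rule soundness[OF cs, rotated]) (simp add: Th_def)
  then show "evt M f a s = evt M f a t" using a by (simp add: models_def)
next
  assume eq: "evt M f a s = evt M f a t"
  note st = assms(2,3)[THEN Eps1_closed]
  have "evt M f b s = evt M f b t" for b
    using eq coincidence(1)[of s a b M f] coincidence(1)[of t a b M f] st by simp
  then show "proves \<tau> (Th \<tau> M f) (Eq s t)"
    using st by (intro hypothesis) (auto simp: Th_def models_def)
qed

lemma ex_assignment:
  assumes "choice_structure \<tau> M f"
  obtains a :: "nat \<Rightarrow> 'm" where "range a \<subseteq> univ (M :: ('r, 'f, 'c, 'm) fo_struct)"
proof -
  from assms obtain m where "m \<in> univ M"
    by (auto simp: choice_structure_def is_fo_struct_def)
  then show ?thesis by (intro that[of "\<lambda>_. m"]) auto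
qed

lemma equiv_eq_rel:
  assumes cs: "choice_structure \<tau> M f"
  shows "equiv (Eps1 \<tau>) (eq_rel \<tau> (Th \<tau> M f))"
proof -
  obtain a :: "nat \<Rightarrow> _" where a: "range a \<subseteq> univ M" using ex_assignment[OF cs] .
  show ?thesis
    by (auto simp: eq_rel_def proves_Eq_iff[OF cs _ _ a]
        intro!: equivI refl_onI symI transI)
qed

lemma trm_class_eq_iff:
  assumes cs: "choice_structure \<tau> M f" and "s \<in> Eps1 \<tau>" "t \<in> Eps1 \<tau>"
    and a: "range a \<subseteq> univ M"
  shows "trm_class \<tau> (Th \<tau> M f) s = trm_class \<tau> (Th \<tau> M f) t \<longleftrightarrow> evt M f a s = evt M f a t"
  unfolding trm_class_def eq_equiv_class_iff[OF equiv_eq_rel[OF cs] assms(2,3)]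
  using assms(2,3) by (simp add: eq_rel_def proves_Eq_iff[OF cs _ _ a])

lemma iff_rel_iff:
  "(\<phi>, \<psi>) \<in> iff_rel \<tau> M f \<longleftrightarrow> wff \<tau> \<phi> \<and> wff \<tau> \<psi> \<and>
     (\<forall>a. range a \<subseteq> univ M \<longrightarrow> sat M f a \<phi> = sat M f a \<psi>)"
  by (auto simp: iff_rel_def models_def)

lemma equiv_iff_rel: "equiv {\<phi>. wff \<tau> \<phi>} (iff_rel \<tau> M f)"
  by (auto simp: iff_rel_iff intro!: equivI refl_onI symI transI)

lemma fm_class_eq_iff:
  "wff \<tau> \<phi> \<Longrightarrow> wff \<tau> \<psi> \<Longrightarrow> fm_class \<tau> M f \<phi> = fm_class \<tau> M f \<psi> \<longleftrightarrow>
     (\<forall>a. range a \<subseteq> univ M \<longrightarrow> sat M f a \<phi> = sat M f a \<psi>)"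
  unfolding fm_class_def by (simp add: eq_equiv_class_iff[OF equiv_iff_rel] iff_rel_iff)

lemma carrier_LT: "carrier (LT \<tau> M f) = fm_class \<tau> M f ` {\<phi>. wff \<tau> \<phi>}"
  by (simp add: LT_def quot_alg_def image_alg_def fm_alg_def fm_class_def)

lemma graph_LT:
  "(xs, y) \<in> graph (LT \<tau> M f) s \<longleftrightarrow>
     (\<exists>\<phi>s. \<phi>s \<in> op_args {\<phi>. wff \<tau> \<phi>} s \<and> xs = map (fm_class \<tau> M f) \<phi>s
        \<and> y = fm_class \<tau> M f (fm_op s \<phi>s))"
  by (auto simp: LT_def quot_alg_def image_alg_def fm_alg_def fm_class_def[abs_def] image_iff)

text \<open>Argument lists by case analysis on the operation symbol.\<close>

lemma op_args_cases:
  assumes "\<phi>s \<in> op_args U s"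
  obtains (Join) \<phi> \<psi> where "s = Join" "\<phi>s = [\<phi>, \<psi>]" "\<phi> \<in> U" "\<psi> \<in> U"
  | (Meet) \<phi> \<psi> where "s = Meet" "\<phi>s = [\<phi>, \<psi>]" "\<phi> \<in> U" "\<psi> \<in> U"
  | (Compl) \<phi> where "s = Compl" "\<phi>s = [\<phi>]" "\<phi> \<in> U"
  | (Zero) "s = Zero" "\<phi>s = []"
  | (One) "s = One" "\<phi>s = []"
  | (Cyl) i \<phi> where "s = Cyl i" "\<phi>s = [\<phi>]" "\<phi> \<in> U"
  | (Diag) i j where "s = Diag i j" "\<phi>s = []"
  using assms
  by (cases s) (auto simp: op_args_def numeral_2_eq_2 length_Suc_conv)

lemma wff_fm_op: "\<phi>s \<in> op_args {\<phi>. wff \<tau> \<phi>} s \<Longrightarrow> wff \<tau> (fm_op s \<phi>s)"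
  by (erule op_args_cases) (auto simp: wff_ExF)

lemma fvf_fm_op:
  assumes "\<phi>s \<in> op_args {\<phi>. fvf \<phi> \<subseteq> {0}} s" "s \<in> cyl_ops {0}"
  shows "fvf (fm_op s \<phi>s) \<subseteq> {0}"
  using assms(1)
proof (cases rule: op_args_cases)
  case (Cyl i \<phi>)
  then show ?thesis using fvf_ExF[of i \<phi>] by auto
qed (use assms(2) in \<open>auto simp: cyl_ops_def\<close>)

lemma sat_fm_op_cong:
  assumes cs: "choice_structure \<tau> M f" and a: "range a \<subseteq> univ M"
    and "\<phi>s \<in> op_args U s"
    and eq: "list_all2 (\<lambda>\<phi> \<psi>. (\<phi>, \<psi>) \<in> iff_rel \<tau> M f) \<phi>s \<psi>s"
  shows "sat M f a (fm_op s \<phi>s) = sat M f a (fm_op s \<psi>s)"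
proof -
  have sat_eq: "sat M f b \<phi> = sat M f b \<psi>"
    if "(\<phi>, \<psi>) \<in> iff_rel \<tau> M f" "range b \<subseteq> univ M" for b \<phi> \<psi>
    using that by (simp add: iff_rel_iff)
  show ?thesis
    using assms(3)
  proof (cases rule: op_args_cases)
    case (Cyl i \<phi>)
    with eq obtain \<psi> where \<psi>: "\<psi>s = [\<psi>]" "(\<phi>, \<psi>) \<in> iff_rel \<tau> M f"
      by (auto simp: list_all2_Cons1)
    have "range (a(i := m)) \<subseteq> univ M" if "m \<in> univ M" for m
      using a that by auto
    then have "sat M f (a(i := m)) \<phi> = sat M f (a(i := m)) \<psi>" if "m \<in> univ M" for m
      using sat_eq[OF \<psi>(2)] that by blast
    then show ?thesis
      by (simp add: Cyl \<psi>(1) sat_ExF[OF cs])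
  qed (use eq in \<open>auto simp: list_all2_Cons1 dest: sat_eq[OF _ a]\<close>)
qed

lemma fm_class_fm_op_cong:
  assumes cs: "choice_structure \<tau> M f"
    and "\<phi>s \<in> op_args {\<phi>. wff \<tau> \<phi>} s" "\<psi>s \<in> op_args {\<phi>. wff \<tau> \<phi>} s"
    and "map (fm_class \<tau> M f) \<phi>s = map (fm_class \<tau> M f) \<psi>s"
  shows "fm_class \<tau> M f (fm_op s \<phi>s) = fm_class \<tau> M f (fm_op s \<psi>s)"
proof -
  have "list_all2 (\<lambda>\<phi> \<psi>. fm_class \<tau> M f \<phi> = fm_class \<tau> M f \<psi>) \<phi>s \<psi>s"
    using assms(4) unfolding list.rel_eq[symmetric] list.rel_map .
  then have "list_all2 (\<lambda>\<phi> \<psi>. (\<phi>, \<psi>) \<in> iff_rel \<tau> M f) \<phi>s \<psi>s"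
  proof (rule list.rel_mono_strong)
    fix \<phi> \<psi> assume "\<phi> \<in> set \<phi>s" "\<psi> \<in> set \<psi>s" "fm_class \<tau> M f \<phi> = fm_class \<tau> M f \<psi>"
    moreover from this have "wff \<tau> \<phi>" "wff \<tau> \<psi>" using assms(2,3) by (auto simp: op_args_def)
    ultimately show "(\<phi>, \<psi>) \<in> iff_rel \<tau> M f" by (simp add: fm_class_eq_iff iff_rel_iff)
  qed
  then show ?thesis
    unfolding fm_class_eq_iff[OF wff_fm_op[OF assms(2)] wff_fm_op[OF assms(3)]]
    using sat_fm_op_cong[OF cs _ assms(2)] by blast
qed

section \<open>The neat reduct\<close>

lemma carrier_Nr1: "carrier (Nr1 A) = {x \<in> carrier A. \<forall>i \<ge> 1. ([x], x) \<in> graph A (Cyl i)}"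
  by (simp add: Nr1_def Let_def)

lemma graph_Nr1:
  "s \<in> cyl_ops {0} \<Longrightarrow>
     graph (Nr1 A) s = graph A s \<inter> (op_args (carrier (Nr1 A)) s \<times> carrier (Nr1 A))"
  by (simp add: Nr1_def Let_def)

lemma fm_class_ExF:
  assumes cs: "choice_structure \<tau> M f" and "wff \<tau> \<phi>"
    and "([fm_class \<tau> M f \<phi>], fm_class \<tau> M f \<phi>) \<in> graph (LT \<tau> M f) (Cyl i)"
  shows "fm_class \<tau> M f (ExF i \<phi>) = fm_class \<tau> M f \<phi>"
proof -
  from assms(3) obtain \<psi>s where \<psi>s: "\<psi>s \<in> op_args {\<phi>. wff \<tau> \<phi>} (Cyl i)"
      "map (fm_class \<tau> M f) [\<phi>] = map (fm_class \<tau> M f) \<psi>s"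
      "fm_class \<tau> M f \<phi> = fm_class \<tau> M f (fm_op (Cyl i) \<psi>s)"
    by (auto simp: graph_LT)
  have "[\<phi>] \<in> op_args {\<phi>. wff \<tau> \<phi>} (Cyl i)" using assms(2) by (simp add: op_args_def)
  from fm_class_fm_op_cong[OF cs this \<psi>s(1,2)] \<psi>s(3) show ?thesis by simp
qed

text \<open>Quantification over a variable that is not free changes nothing, as the universe is nonempty.\<close>

lemma fm_class_in_Nr1:
  assumes cs: "choice_structure \<tau> M f" and wf: "wff \<tau> \<phi>" and fv: "fvf \<phi> \<subseteq> {0}"
  shows "fm_class \<tau> M f \<phi> \<in> carrier (Nr1 (LT \<tau> M f))"
proof -
  have "([fm_class \<tau> M f \<phi>], fm_class \<tau> M f \<phi>) \<in> graph (LT \<tau> M f) (Cyl i)" if "i \<ge> 1" for i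
  proof -
    have "sat M f (a(i := m)) \<phi> = sat M f a \<phi>" for a m
      by (rule coincidence) (use fv that in auto)
    moreover have "univ M \<noteq> {}"
      using cs by (auto simp: choice_structure_def is_fo_struct_def)
    ultimately have "sat M f a (ExF i \<phi>) = sat M f a \<phi>" for a
      by (auto simp: sat_ExF[OF cs])
    then have "fm_class \<tau> M f \<phi> = fm_class \<tau> M f (fm_op (Cyl i) [\<phi>])"
      by (simp add: fm_class_eq_iff wf wff_ExF)
    then show ?thesis
      unfolding graph_LT by (intro exI[of _ "[\<phi>]"]) (simp add: op_args_def wf)
  qed
  then show ?thesis using wf by (auto simp: carrier_Nr1 carrier_LT)
qed

text \<open>
  An element of the neat reduct is a fixed point of all \<open>c\<^sub>i\<close> with \<open>i \<ge> 1\<close>, so quantifying away the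
  finitely many free variables other than \<open>v\<^sub>0\<close> of a representative, one by one, does not change
  its class.
\<close>

lemma Nr1_representative:
  assumes cs: "choice_structure \<tau> M f" and x: "x \<in> carrier (Nr1 (LT \<tau> M f))"
  shows "\<exists>\<phi>. wff \<tau> \<phi> \<and> fvf \<phi> \<subseteq> {0} \<and> x = fm_class \<tau> M f \<phi>"
proof -
  have "\<exists>\<psi>. wff \<tau> \<psi> \<and> fvf \<psi> \<subseteq> {0} \<and> x = fm_class \<tau> M f \<psi>"
    if "wff \<tau> \<phi>" "x = fm_class \<tau> M f \<phi>" for \<phi>
    using that
  proof (induction "card (fvf \<phi> - {0})" arbitrary: \<phi> rule: less_induct)
    case less
    show ?case
    proof (cases "fvf \<phi> \<subseteq> {0}")
      case False
      then obtain i where i: "i \<in> fvf \<phi>" "i \<ge> 1" by (auto simp: Suc_le_eq)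
      have "fvf (ExF i \<phi>) - {0} \<subset> fvf \<phi> - {0}" using fvf_ExF[of i \<phi>] i by auto
      then have "card (fvf (ExF i \<phi>) - {0}) < card (fvf \<phi> - {0})"
        by (intro psubset_card_mono) (simp_all add: finite_fv)
      moreover have "x = fm_class \<tau> M f (ExF i \<phi>)"
        using fm_class_ExF[OF cs less.prems(1), of i] x i less.prems(2) by (simp add: carrier_Nr1)
      ultimately show ?thesis using less.hyps wff_ExF[OF less.prems(1)] by blast
    qed (use less.prems in blast)
  qed
  then show ?thesis using x by (auto simp: carrier_Nr1 carrier_LT)
qed

lemma carrier_Nr1_LT:
  assumes "choice_structure \<tau> M f"
  shows "carrier (Nr1 (LT \<tau> M f)) = fm_class \<tau> M f ` {\<phi>. wff \<tau> \<phi> \<and> fvf \<phi> \<subseteq> {0}}"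
  using Nr1_representative[OF assms] fm_class_in_Nr1[OF assms] by blast

lemma op_args_image: "op_args (h ` U) s = map h ` op_args U s"
proof
  show "op_args (h ` U) s \<subseteq> map h ` op_args U s"
  proof
    fix ys assume "ys \<in> op_args (h ` U) s"
    then have "ys \<in> lists (h ` U)" and len: "length ys = op_ar s" by (auto simp: op_args_def)
    then obtain xs where "xs \<in> lists U" "ys = map h xs" by (auto simp: lists_image)
    then show "ys \<in> map h ` op_args U s" using len by (auto simp: op_args_def)
  qed
next
  show "map h ` op_args U s \<subseteq> op_args (h ` U) s" unfolding op_args_def by fastforce
qed

lemma is_algebra_Nr1_LT:
  assumes cs: "choice_structure \<tau> M f"
  shows "is_algebra {0} (Nr1 (LT \<tau> M f))"
  unfolding is_algebra_def
proof (intro ballI conjI)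
  let ?U = "carrier (Nr1 (LT \<tau> M f))"
  fix s assume s: "s \<in> cyl_ops {0}"
  show "graph (Nr1 (LT \<tau> M f)) s \<subseteq> op_args ?U s \<times> ?U"
    by (auto simp: graph_Nr1[OF s])
  fix xs assume xs: "xs \<in> op_args ?U s"
  then obtain \<phi>s where \<phi>s: "\<phi>s \<in> op_args {\<phi>. wff \<tau> \<phi> \<and> fvf \<phi> \<subseteq> {0}} s"
      "xs = map (fm_class \<tau> M f) \<phi>s"
    unfolding carrier_Nr1_LT[OF cs] op_args_image by blast
  then have wf: "\<phi>s \<in> op_args {\<phi>. wff \<tau> \<phi>} s" and fv: "\<phi>s \<in> op_args {\<phi>. fvf \<phi> \<subseteq> {0}} s"
    by (auto simp: op_args_def)
  let ?y = "fm_class \<tau> M f (fm_op s \<phi>s)"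
  show "\<exists>!y. (xs, y) \<in> graph (Nr1 (LT \<tau> M f)) s"
  proof
    have "?y \<in> ?U"
      using fm_class_in_Nr1[OF cs wff_fm_op[OF wf] fvf_fm_op[OF fv s]] .
    moreover have "(xs, ?y) \<in> graph (LT \<tau> M f) s"
      unfolding graph_LT using \<phi>s(2) wf by blast
    ultimately show "(xs, ?y) \<in> graph (Nr1 (LT \<tau> M f)) s"
      unfolding graph_Nr1[OF s] using xs by blast
    fix y assume "(xs, y) \<in> graph (Nr1 (LT \<tau> M f)) s"
    then obtain \<psi>s where "\<psi>s \<in> op_args {\<phi>. wff \<tau> \<phi>} s" "xs = map (fm_class \<tau> M f) \<psi>s"
        "y = fm_class \<tau> M f (fm_op s \<psi>s)"
      unfolding graph_Nr1[OF s] Int_iff graph_LT by blast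
    then show "y = ?y"
      using fm_class_fm_op_cong[OF cs _ wf] \<phi>s(2) by metis
  qed
qed

section \<open>The map onto the canonical universe\<close>

lemma Phi_fm_class:
  assumes cs: "choice_structure \<tau> M f" and wf: "wff \<tau> \<phi>" and fv: "fvf \<phi> \<subseteq> {0}"
  shows "Phi \<tau> M f (fm_class \<tau> M f \<phi>) = trm_class \<tau> (Th \<tau> M f) (EpsT 0 \<phi>)"
proof -
  obtain a :: "nat \<Rightarrow> _" where a: "range a \<subseteq> univ M" using ex_assignment[OF cs] .
  have "trm_class \<tau> (Th \<tau> M f) (EpsT 0 \<psi>) = trm_class \<tau> (Th \<tau> M f) (EpsT 0 \<phi>)"
    if \<psi>: "\<psi> \<in> fm_class \<tau> M f \<phi>" "fvf \<psi> \<subseteq> {0}" for \<psi>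
  proof -
    have \<psi>': "wff \<tau> \<psi>" "\<And>a. range a \<subseteq> univ M \<Longrightarrow> sat M f a \<phi> = sat M f a \<psi>"
      using \<psi>(1) by (auto simp: fm_class_def iff_rel_iff)
    have "range (a(0 := m)) \<subseteq> univ M" if "m \<in> univ M" for m
      using a that by auto
    then have "{m \<in> univ M. sat M f (a(0 := m)) \<psi>} = {m \<in> univ M. sat M f (a(0 := m)) \<phi>}"
      using \<psi>'(2) by blast
    then have "evt M f a (EpsT 0 \<psi>) = evt M f a (EpsT 0 \<phi>)" by simp
    moreover have "EpsT 0 \<psi> \<in> Eps1 \<tau>" "EpsT 0 \<phi> \<in> Eps1 \<tau>"
      using wf fv \<psi>'(1) \<psi>(2) by (auto simp: Eps1_def)
    ultimately show ?thesis using trm_class_eq_iff[OF cs _ _ a] by blast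
  qed
  moreover have "\<phi> \<in> fm_class \<tau> M f \<phi>"
    using wf by (simp add: fm_class_def iff_rel_iff)
  ultimately show ?thesis using fv unfolding Phi_def by blast
qed

text \<open>
  Up to equality provable from the theory of the structure, the variable bound by a closed epsilon
  term can be taken to be \<open>v\<^sub>0\<close>.
\<close>

lemma Phi_surj:
  assumes cs: "choice_structure \<tau> M f"
  shows "Phi \<tau> M f ` carrier (Nr1 (LT \<tau> M f)) = Can \<tau> M f"
proof -
  define C where "C = trm_class \<tau> (Th \<tau> M f)"
  let ?F = "{\<psi>. wff \<tau> \<psi> \<and> fvf \<psi> \<subseteq> {0}}"
  obtain a :: "nat \<Rightarrow> _" where a: "range a \<subseteq> univ M" using ex_assignment[OF cs] .
  have sub: "EpsT 0 \<psi> \<in> Eps1 \<tau>" if "\<psi> \<in> ?F" for \<psi>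
    using that by (auto simp: Eps1_def)
  have rename: "C t \<in> (\<lambda>\<psi>. C (EpsT 0 \<psi>)) ` ?F" if t: "t \<in> Eps1 \<tau>" for t
  proof -
    from t obtain i \<phi> where \<phi>: "t = EpsT i \<phi>" "wff \<tau> \<phi>" "fvf \<phi> \<subseteq> {i}"
      by (auto simp: Eps1_def)
    let ?\<psi> = "\<phi>[Var 0//i]"
    have \<psi>: "?\<psi> \<in> ?F"
      using \<phi> fvf_inst[of \<phi> "Var 0" i] by (auto intro: wff_inst)
    have "sat M f (a(0 := m)) ?\<psi> = sat M f (a(i := m)) \<phi>" for m
      unfolding sat_inst by (rule coincidence) (use \<phi> in auto)
    then have "evt M f a t = evt M f a (EpsT 0 ?\<psi>)" by (simp add: \<phi>(1))
    then have "C t = C (EpsT 0 ?\<psi>)"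
      unfolding C_def by (simp add: trm_class_eq_iff[OF cs t sub[OF \<psi>] a])
    then show ?thesis using \<psi> by (rule image_eqI)
  qed
  have "Phi \<tau> M f ` carrier (Nr1 (LT \<tau> M f)) = (\<lambda>\<psi>. C (EpsT 0 \<psi>)) ` ?F"
    unfolding carrier_Nr1_LT[OF cs] image_image C_def
    by (rule image_cong) (auto simp: Phi_fm_class[OF cs])
  also have "\<dots> = C ` Eps1 \<tau>"
    using sub rename by blast
  also have "\<dots> = Can \<tau> M f"
    by (auto simp: C_def Can_def quotient_def trm_class_def)
  finally show ?thesis .
qed

section \<open>Quotients by kernels\<close>

lemma Ker_class_eq_iff:
  assumes "x \<in> carrier A" "y \<in> carrier A"
  shows "Ker A h `` {x} = Ker A h `` {y} \<longleftrightarrow> h x = h y"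
  using assms by (auto simp: Ker_def)

text \<open>
  The bijection between the quotient by the kernel and the image respects the graphs of the
  operations whether or not the kernel is a congruence.
\<close>

lemma quot_Ker_isomorphic_image:
  assumes "\<And>s. s \<in> cyl_ops I \<Longrightarrow> graph A s \<subseteq> op_args (carrier A) s \<times> carrier A"
  shows "isomorphic I (quot_alg A (Ker A h)) (image_alg h A)"
proof -
  let ?q = "\<lambda>x. Ker A h `` {x}"
  \<comment> \<open>\<open>h\<close> is constant on kernel classes, so \<open>h ` X\<close> is a singleton.\<close>
  define k where "k X = the_elem (h ` X)" for X
  have k: "k (?q x) = h x" if "x \<in> carrier A" for x
  proof -
    have "h ` ?q x = {h x}" using that by (auto simp: Ker_def)
    then show ?thesis by (simp add: k_def)
  qed
  have "bij_betw k (?q ` carrier A) (h ` carrier A)"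
    by (rule bij_betw_imageI) (auto simp: inj_on_def k Ker_class_eq_iff image_image)
  moreover have "map_prod (map k) k ` map_prod (map ?q) ?q ` graph A s
      = map_prod (map h) h ` graph A s" if "s \<in> cyl_ops I" for s
    unfolding image_image
  proof (rule image_cong)
    fix p assume "p \<in> graph A s"
    then have "p \<in> op_args (carrier A) s \<times> carrier A" using assms[OF that] by blast
    then have "set (fst p) \<subseteq> carrier A" "snd p \<in> carrier A"
      by (auto simp: op_args_def)
    then show "map_prod (map k) k (map_prod (map ?q) ?q p) = map_prod (map h) h p"
      using k by (cases p) (auto simp: subset_iff)
  qed simp
  ultimately show ?thesis
    unfolding isomorphic_def quot_alg_def image_alg_def by (intro exI[of _ k]) simp
qed

text \<open>
  A surjective homomorphism between algebras carries the graphs of the operations onto each other: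
  totality of the operations in \<open>A\<close> provides a value over every argument list, and
  single-valuedness in \<open>B\<close> leaves no other.
\<close>

lemma surjective_hom_graph:
  assumes A: "is_algebra I A" and B: "is_algebra I B" and hom: "is_hom I A B h"
    and surj: "h ` carrier A = carrier B" and s: "s \<in> cyl_ops I"
  shows "graph B s = map_prod (map h) h ` graph A s"
proof
  show "map_prod (map h) h ` graph A s \<subseteq> graph B s"
    using hom s by (auto simp: is_hom_def)
  show "graph B s \<subseteq> map_prod (map h) h ` graph A s"
  proof (rule subrelI)
    fix ys y assume ys: "(ys, y) \<in> graph B s"
    then have ysB: "ys \<in> op_args (h ` carrier A) s"
      using B s surj by (auto simp: is_algebra_def)
    then obtain xs where xs: "xs \<in> op_args (carrier A) s" "ys = map h xs"
      unfolding op_args_image by blast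
    then obtain x where x: "(xs, x) \<in> graph A s"
      using A s unfolding is_algebra_def by blast
    then have "(ys, h x) \<in> graph B s" using hom s xs(2) by (auto simp: is_hom_def)
    then have "y = h x" using B s ys ysB unfolding surj is_algebra_def by blast
    then show "(ys, y) \<in> map_prod (map h) h ` graph A s" using x xs(2) by force
  qed
qed

lemma isomorphic_image_alg_cong:
  assumes "isomorphic I Q (image_alg h A)" "h ` carrier A = carrier B"
    and "\<And>s. s \<in> cyl_ops I \<Longrightarrow> graph B s = map_prod (map h) h ` graph A s"
  shows "isomorphic I Q B"
  using assms unfolding isomorphic_def image_alg_def by simp

lemma is_algebra_isomorphic:
  assumes iso: "isomorphic I A B" and B: "is_algebra I B"
    and A: "\<And>s. s \<in> cyl_ops I \<Longrightarrow> graph A s \<subseteq> op_args (carrier A) s \<times> carrier A"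
  shows "is_algebra I A"
  unfolding is_algebra_def
proof (intro ballI conjI)
  obtain h where bij: "bij_betw h (carrier A) (carrier B)"
    and h: "\<And>s. s \<in> cyl_ops I \<Longrightarrow> map_prod (map h) h ` graph A s = graph B s"
    using iso by (auto simp: isomorphic_def)
  have inj: "inj_on h (carrier A)" using bij by (rule bij_betw_imp_inj_on)
  fix s assume s: "s \<in> cyl_ops I"
  show "graph A s \<subseteq> op_args (carrier A) s \<times> carrier A" using A[OF s] .
  fix xs assume xs: "xs \<in> op_args (carrier A) s"
  then have "map h xs \<in> op_args (carrier B) s"
    using bij by (auto simp: op_args_image bij_betw_def[of h] simp flip: bij_betw_imp_surj_on[OF bij])
  then have ex1: "\<exists>!y. (map h xs, y) \<in> graph B s" using B s by (auto simp: is_algebra_def)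
  then obtain y where "(map h xs, y) \<in> map_prod (map h) h ` graph A s" using h[OF s] by auto
  then obtain xs' z where z: "(xs', z) \<in> graph A s" "map h xs = map h xs'" by auto
  have "xs' = xs"
  proof (rule map_inj_on)
    have "set xs' \<union> set xs \<subseteq> carrier A" using A[OF s] z(1) xs by (auto simp: op_args_def)
    then show "inj_on h (set xs' \<union> set xs)" by (rule inj_on_subset[OF inj])
  qed (use z(2) in simp)
  show "\<exists>!y. (xs, y) \<in> graph A s"
  proof
    show "(xs, z) \<in> graph A s" using z(1) \<open>xs' = xs\<close> by simp
    fix w assume w: "(xs, w) \<in> graph A s"
    have "(map h xs, h w) \<in> graph B s" "(map h xs, h z) \<in> graph B s"
      using w z(1) \<open>xs' = xs\<close> h[OF s] by force+
    then have "h w = h z" using ex1 by blast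
    then show "w = z" using inj A[OF s] w z(1) by (auto dest: inj_onD)
  qed
qed

lemma graph_image_alg_subset:
  assumes "graph A s \<subseteq> op_args (carrier A) s \<times> carrier A"
  shows "graph (image_alg h A) s
    \<subseteq> op_args (carrier (image_alg h A)) s \<times> carrier (image_alg h A)"
  using assms by (fastforce simp: image_alg_def op_args_def)

text \<open>The first isomorphism theorem for algebras given by the graphs of their operations.\<close>

lemma quot_Ker_isomorphic:
  assumes A: "is_algebra I A" and B: "is_algebra I B" and hom: "is_hom I A B h"
    and surj: "h ` carrier A = carrier B"
  shows "is_algebra I (quot_alg A (Ker A h)) \<and> isomorphic I (quot_alg A (Ker A h)) B"
proof -
  have gA: "graph A s \<subseteq> op_args (carrier A) s \<times> carrier A" if "s \<in> cyl_ops I" for s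
    using A that by (auto simp: is_algebra_def)
  have iso: "isomorphic I (quot_alg A (Ker A h)) B"
    using quot_Ker_isomorphic_image[OF gA] surj surjective_hom_graph[OF assms]
    by (rule isomorphic_image_alg_cong)
  moreover have "is_algebra I (quot_alg A (Ker A h))"
    using iso B unfolding quot_alg_def
    by (rule is_algebra_isomorphic) (rule graph_image_alg_subset[OF gA])
  ultimately show ?thesis by blast
qed

section \<open>The isomorphism with the canonical algebra\<close>

theorem proposition5:
  fixes \<tau> :: "('r, 'f) sim_type"
    and M :: "('r, 'f, 'c, 'm) fo_struct"
    and f :: "'m set \<Rightarrow> 'm"
    and T :: "('r, 'f, 'c) fm set"
  assumes "choice_structure \<tau> M f"
    and "T = Th \<tau> M f"
  shows "is_algebra {0} (Nr1 (LT \<tau> M f))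
    \<and> (\<forall>x \<in> carrier (Nr1 (LT \<tau> M f)). \<exists>\<phi>. wff \<tau> \<phi> \<and> fvf \<phi> \<subseteq> {0} \<and> x = fm_class \<tau> M f \<phi>)
    \<and> (\<forall>\<phi>. wff \<tau> \<phi> \<and> fvf \<phi> \<subseteq> {0} \<longrightarrow>
          fm_class \<tau> M f \<phi> \<in> carrier (Nr1 (LT \<tau> M f))
          \<and> Phi \<tau> M f (fm_class \<tau> M f \<phi>) = trm_class \<tau> T (EpsT 0 \<phi>))
    \<and> Phi \<tau> M f ` carrier (Nr1 (LT \<tau> M f)) = Can \<tau> M f
    \<and> isomorphic {0}
          (quot_alg (Nr1 (LT \<tau> M f)) (Ker (Nr1 (LT \<tau> M f)) (Phi \<tau> M f)))
          (Can_alg \<tau> M f)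
    \<and> (\<forall>B. is_algebra {0} B \<and> carrier B = Can \<tau> M f
            \<and> is_hom {0} (Nr1 (LT \<tau> M f)) B (Phi \<tau> M f) \<longrightarrow>
          is_algebra {0} (quot_alg (Nr1 (LT \<tau> M f)) (Ker (Nr1 (LT \<tau> M f)) (Phi \<tau> M f)))
          \<and> isomorphic {0}
              (quot_alg (Nr1 (LT \<tau> M f)) (Ker (Nr1 (LT \<tau> M f)) (Phi \<tau> M f))) B)"
proof (intro conjI)
  note cs = assms(1)
  show alg: "is_algebra {0} (Nr1 (LT \<tau> M f))" using is_algebra_Nr1_LT[OF cs] .
  show "\<forall>x \<in> carrier (Nr1 (LT \<tau> M f)). \<exists>\<phi>. wff \<tau> \<phi> \<and> fvf \<phi> \<subseteq> {0} \<and> x = fm_class \<tau> M f \<phi>"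
    using Nr1_representative[OF cs] by blast
  show "\<forall>\<phi>. wff \<tau> \<phi> \<and> fvf \<phi> \<subseteq> {0} \<longrightarrow>
      fm_class \<tau> M f \<phi> \<in> carrier (Nr1 (LT \<tau> M f))
      \<and> Phi \<tau> M f (fm_class \<tau> M f \<phi>) = trm_class \<tau> T (EpsT 0 \<phi>)"
    using fm_class_in_Nr1[OF cs] Phi_fm_class[OF cs] assms(2) by blast
  show surj: "Phi \<tau> M f ` carrier (Nr1 (LT \<tau> M f)) = Can \<tau> M f" using Phi_surj[OF cs] .
  show "isomorphic {0}
      (quot_alg (Nr1 (LT \<tau> M f)) (Ker (Nr1 (LT \<tau> M f)) (Phi \<tau> M f))) (Can_alg \<tau> M f)"
    unfolding Can_alg_def
    by (rule quot_Ker_isomorphic_image) (use alg in \<open>simp add: is_algebra_def\<close>)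
  show "\<forall>B. is_algebra {0} B \<and> carrier B = Can \<tau> M f
      \<and> is_hom {0} (Nr1 (LT \<tau> M f)) B (Phi \<tau> M f) \<longrightarrow>
      is_algebra {0} (quot_alg (Nr1 (LT \<tau> M f)) (Ker (Nr1 (LT \<tau> M f)) (Phi \<tau> M f)))
      \<and> isomorphic {0}
          (quot_alg (Nr1 (LT \<tau> M f)) (Ker (Nr1 (LT \<tau> M f)) (Phi \<tau> M f))) B"
    using quot_Ker_isomorphic[OF alg] surj by metis
qed

end
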